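(* Consider a truncated affine arrangement $\mathcal{A}^{a,b}_{n-1}$ with integers $a,b$ satisfying $1\le a\le b\le a+1$. A valid associated weighted digraph is $m$-acyclic if and only if it contains no $m$-ascending cycle of length three.
   Context: For integers $a,b$ with $a+b\ge 2$, the truncated affine arrangement $\mathcal{A}^{a,b}_{n-1}$ consists of the hyperplanes $x_i-x_j=1-a,2-a,\ldots,b-1$, $1\le i<j\le n$, in $V_{n-1}=\{x\in\mathbb{R}^n: x_1+\cdots+x_n=0\}$. A weighted digraph on $\{1,\ldots,n\}$ is a valid weighted digraph associated to $\mathcal{A}^{a,b}_{n-1}$ if for each $i<j$ exactly one of the following holds: (1) there is no edge $i\rightarrow j$ and there is exactly one edge $j\rightarrow i$, of weight $a-1$; (2) there is exactly one edge $i\rightarrow j$, of weight $w$, and exactly one edge $j\rightarrow i$, of weight $-w-1$, for some integer $w$ with $1-a\le w\le b-2$; (3) there is exactly one edge $i\rightarrow j$, of weight $b-1$, and there is no edge $j\rightarrow i$. An $m$-ascending cycle is a directed cycle whose total weight is nonnegative; a weighted digraph is $m$-acyclic if it contains no $m$-ascending cycle. The length of a cycle is its number of edges. *)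

theory Defs
  imports "Graph_Theory.Arc_Walk"
begin

definition arcs_between :: "('a, 'e) pre_digraph \<Rightarrow> 'a \<Rightarrow> 'a \<Rightarrow> 'e set" where
  "arcs_between G u v = {e \<in> arcs G. tail G e = u \<and> head G e = v}"

definition unique_arc_of_weight ::
  "('a, 'e) pre_digraph \<Rightarrow> ('e \<Rightarrow> int) \<Rightarrow> 'a \<Rightarrow> 'a \<Rightarrow> int \<Rightarrow> bool" where
  "unique_arc_of_weight G c u v w \<longleftrightarrow> (\<exists>e. arcs_between G u v = {e} \<and> c e = w)"

text \<open>
  The truncated affine arrangement with parameters \<open>a\<close>, \<open>b\<close>, \<open>n\<close> consists of the hyperplanes
  \<open>x_i - x_j = s\<close> with \<open>1 - a \<le> s \<le> b - 1\<close> and \<open>1 \<le> i < j \<le> n\<close> in the space of all \<open>x\<close> in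
  \<open>R^n\<close> with coordinate sum \<open>0\<close>. It enters the notion of a valid weighted digraph only
  through \<open>a\<close>, \<open>b\<close> and \<open>n\<close>. The next three predicates are the three alternatives for a pair
  \<open>i < j\<close>.
\<close>

definition only_backward_arc ::
  "int \<Rightarrow> ('a, 'e) pre_digraph \<Rightarrow> ('e \<Rightarrow> int) \<Rightarrow> 'a \<Rightarrow> 'a \<Rightarrow> bool" where
  "only_backward_arc a G c i j \<longleftrightarrow>
     arcs_between G i j = {} \<and> unique_arc_of_weight G c j i (a - 1)"

definition arcs_both_ways ::
  "int \<Rightarrow> int \<Rightarrow> ('a, 'e) pre_digraph \<Rightarrow> ('e \<Rightarrow> int) \<Rightarrow> 'a \<Rightarrow> 'a \<Rightarrow> bool" where
  "arcs_both_ways a b G c i j \<longleftrightarrow>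
     (\<exists>w. 1 - a \<le> w \<and> w \<le> b - 2 \<and>
        unique_arc_of_weight G c i j w \<and> unique_arc_of_weight G c j i (- w - 1))"

definition only_forward_arc ::
  "int \<Rightarrow> ('a, 'e) pre_digraph \<Rightarrow> ('e \<Rightarrow> int) \<Rightarrow> 'a \<Rightarrow> 'a \<Rightarrow> bool" where
  "only_forward_arc b G c i j \<longleftrightarrow>
     unique_arc_of_weight G c i j (b - 1) \<and> arcs_between G j i = {}"

text \<open>
  The conditions on pairs \<open>i < j\<close> say nothing about loops; as usual for digraphs, loops are
  excluded. (A loop would count as a cycle of length one for \<^const>\<open>pre_digraph.cycle\<close>.)
\<close>

definition valid_weighted_digraph ::
  "int \<Rightarrow> int \<Rightarrow> nat \<Rightarrow> (nat, 'e) pre_digraph \<Rightarrow> ('e \<Rightarrow> int) \<Rightarrow> bool" where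
  "valid_weighted_digraph a b n G c \<longleftrightarrow>
     loopfree_digraph G \<and> verts G = {1..n} \<and>
     (\<forall>i\<in>{1..n}. \<forall>j\<in>{1..n}. i < j \<longrightarrow>
        (only_backward_arc a G c i j \<and> \<not> arcs_both_ways a b G c i j \<and> \<not> only_forward_arc b G c i j) \<or>
        (\<not> only_backward_arc a G c i j \<and> arcs_both_ways a b G c i j \<and> \<not> only_forward_arc b G c i j) \<or>
        (\<not> only_backward_arc a G c i j \<and> \<not> arcs_both_ways a b G c i j \<and> only_forward_arc b G c i j))"

definition m_ascending_cycle ::
  "('a, 'e) pre_digraph \<Rightarrow> ('e \<Rightarrow> int) \<Rightarrow> 'e awalk \<Rightarrow> bool" where
  "m_ascending_cycle G c p \<longleftrightarrow> pre_digraph.cycle G p \<and> 0 \<le> (\<Sum>e\<leftarrow>p. c e)"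

definition m_acyclic :: "('a, 'e) pre_digraph \<Rightarrow> ('e \<Rightarrow> int) \<Rightarrow> bool" where
  "m_acyclic G c \<longleftrightarrow> \<not> (\<exists>p. m_ascending_cycle G c p)"

end

theory Submission
  imports Defs "HOL-Number_Theory.Cong"
begin

text \<open>
  Only the implication from long cycles to triangles needs an argument, and it suffices to shorten
  a cycle \<open>v\<^sub>0, v\<^sub>1, \<dots>\<close> of length \<open>k \<ge> 4\<close> and weight \<open>S \<ge> 0\<close> to one of length \<open>3\<close> or
  \<open>k - 1\<close> that is still ascending. Write \<open>e\<^sub>i\<close> for the weight of \<open>v\<^sub>i \<rightarrow> v\<^sub>i\<^sub>+\<^sub>1\<close>, and look at the chords
  between \<open>v\<^sub>i\<close> and \<open>v\<^sub>i\<^sub>+\<^sub>2\<close>. The arc \<open>v\<^sub>i \<rightarrow> v\<^sub>i\<^sub>+\<^sub>2\<close>, if present, gives a cycle of length \<open>k - 1\<close>; the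
  arc \<open>v\<^sub>i\<^sub>+\<^sub>2 \<rightarrow> v\<^sub>i\<close>, if present, gives a triangle. Assume that none of these is ascending.

  If both arcs of a chord are present, their weights add up to \<open>- 1\<close>, so the two smaller cycles
  have total weight \<open>S - 1 \<ge> - 1\<close>; but two negative integers add up to at most \<open>- 2\<close>. Hence every
  chord is a single arc. A single arc \<open>u \<rightarrow> v\<close> has the largest weight \<open>M u v\<close> possible in its
  direction, \<open>b - 1\<close> or \<open>a - 1\<close>, which is nonnegative. So each pair sum \<open>e\<^sub>i + e\<^sub>i\<^sub>+\<^sub>1\<close> is either
  \<^emph>\<open>large\<close>, at least \<open>M v\<^sub>i v\<^sub>i\<^sub>+\<^sub>2 + 1\<close>, while the remaining \<open>k - 2\<close> arcs have negative total weight, or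
  \<^emph>\<open>small\<close>, at most \<open>- M v\<^sub>i\<^sub>+\<^sub>2 v\<^sub>i - 1\<close> (lemma \<open>pair_dichotomy\<close>).

  The hypothesis \<open>a \<le> b \<le> a + 1\<close> makes \<open>M\<close> almost constant. As \<open>e\<^sub>i \<le> M v\<^sub>i v\<^sub>i\<^sub>+\<^sub>1\<close>, both terms of a large
  pair are then nonnegative, and a large pair cannot be followed by a small one
  (lemma \<open>pair_sign_propagates\<close>). So if one pair is large, then going around the cycle all are,
  and no arc is negative, which contradicts the negative weight of the remaining arcs. If no pair
  is large, then every pair sum is negative, yet the pair sums add up to \<open>2 S \<ge> 0\<close>.

  Finally, an ascending cycle has length at least three: there are no loops, and a cycle of length
  two has weight \<open>- 1\<close>.
\<close>

section \<open>Cycles as periodic vertex sequences\<close>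

text \<open>
  A cycle is represented by an infinite sequence of vertices going around it, so that every index
  can serve as the starting point and rotating a cycle costs nothing.
\<close>

definition periodic_cycle :: "('a \<Rightarrow> 'a \<Rightarrow> bool) \<Rightarrow> nat \<Rightarrow> (nat \<Rightarrow> 'a) \<Rightarrow> bool" where
  "periodic_cycle A k v \<longleftrightarrow>
     (\<forall>i. A (v i) (v (Suc i))) \<and> (\<forall>i j. v i = v j \<longleftrightarrow> i mod k = j mod k)"

definition cycle_weight :: "('a \<Rightarrow> 'a \<Rightarrow> int) \<Rightarrow> nat \<Rightarrow> (nat \<Rightarrow> 'a) \<Rightarrow> int" where
  "cycle_weight W k v = (\<Sum>i<k. W (v i) (v (Suc i)))"

lemma cycle_weight_3:
  "cycle_weight W 3 v = W (v 0) (v 1) + W (v 1) (v 2) + W (v 2) (v 3)"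
  by (simp add: cycle_weight_def numeral_3_eq_3 numeral_2_eq_2)

lemma sum_window_periodic:
  fixes f :: "nat \<Rightarrow> 'b::comm_monoid_add"
  assumes "\<And>i. f (i + k) = f i"
  shows "(\<Sum>i<k. f (s + i)) = (\<Sum>i<k. f i)"
proof (induction s)
  case (Suc s)
  show ?case
  proof (cases k)
    case (Suc l)
    have "(\<Sum>i<k. f (Suc s + i)) = (\<Sum>i<l. f (Suc s + i)) + f (s + k)"
      using Suc by simp
    also have "\<dots> = f (s + 0) + (\<Sum>i<l. f (s + Suc i))"
      using assms[of s] by (simp add: add.commute)
    also have "\<dots> = (\<Sum>i<k. f (s + i))"
      unfolding Suc by (rule sum.lessThan_Suc_shift[symmetric])
    finally show ?thesis using Suc.IH by simp
  qed simp
qed simp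

lemma mod_window_eq_iff:
  fixes s i j k :: nat
  assumes "i < k" "j < k"
  shows "(s + i) mod k = (s + j) mod k \<longleftrightarrow> i = j"
proof
  assume "(s + i) mod k = (s + j) mod k"
  then have "[s + i = s + j] (mod k)" by (simp add: unique_euclidean_semiring_class.cong_def)
  then have "[i = j] (mod k)" by (simp add: cong_add_lcancel_nat)
  then show "i = j" using assms by (simp add: cong_less_modulus_unique_nat)
qed simp

context
  fixes A :: "'a \<Rightarrow> 'a \<Rightarrow> bool" and W :: "'a \<Rightarrow> 'a \<Rightarrow> int" and k :: nat and v :: "nat \<Rightarrow> 'a"
  assumes cyc: "periodic_cycle A k v"
begin

lemma periodic_cycle_shift: "v (i + k) = v i"
  using cyc by (simp add: periodic_cycle_def)

lemma periodic_cycle_window_inj: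
  "i < k \<Longrightarrow> j < k \<Longrightarrow> v (s + i) = v (s + j) \<longleftrightarrow> i = j"
  using cyc by (simp add: periodic_cycle_def mod_window_eq_iff)

lemma cycle_weight_window:
  "(\<Sum>i<k. W (v (s + i)) (v (Suc (s + i)))) = cycle_weight W k v"
  unfolding cycle_weight_def
  by (rule sum_window_periodic[where f = "\<lambda>i. W (v i) (v (Suc i))"])
     (metis periodic_cycle_shift add_Suc)

lemma periodic_cycle_step: "A (v i) (v (Suc i))"
  using cyc by (simp add: periodic_cycle_def)

text \<open>
  A chord joining \<open>v s\<close> and \<open>v (s + 2)\<close> cuts the cycle into a triangle and a cycle of length
  \<open>k - 1\<close>; its direction decides which of the two is a directed cycle.
\<close>

lemma triangle_of_back_chord:
  assumes "k \<ge> 3" and "A (v (s + 2)) (v s)"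
  obtains u where "periodic_cycle A 3 u"
    and "cycle_weight W 3 u =
      W (v s) (v (Suc s)) + W (v (Suc s)) (v (s + 2)) + W (v (s + 2)) (v s)"
proof
  let ?u = "\<lambda>j. v (s + j mod 3)"
  have "A (?u i) (?u (Suc i))" for i
  proof (cases "Suc (i mod 3) = 3")
    case True
    then have "i mod 3 = 2" by simp
    then show ?thesis using assms(2) by (simp add: mod_Suc)
  next
    case False
    then show ?thesis using periodic_cycle_step[of "s + i mod 3"] by (simp add: mod_Suc)
  qed
  moreover have "?u i = ?u j \<longleftrightarrow> i mod 3 = j mod 3" for i j
  proof (rule periodic_cycle_window_inj)
    show "i mod 3 < k" "j mod 3 < k"
      using assms(1) mod_less_divisor[of 3 i] mod_less_divisor[of 3 j] by linarith+
  qed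
  ultimately show "periodic_cycle A 3 ?u" by (simp add: periodic_cycle_def)
  show "cycle_weight W 3 ?u =
      W (v s) (v (Suc s)) + W (v (Suc s)) (v (s + 2)) + W (v (s + 2)) (v s)"
    by (simp add: cycle_weight_3)
qed

lemma shortcut_of_forward_chord:
  assumes "k \<ge> 3" and "A (v s) (v (s + 2))"
  obtains u where "periodic_cycle A (k - 1) u"
    and "cycle_weight W (k - 1) u = cycle_weight W k v
      - (W (v s) (v (Suc s)) + W (v (Suc s)) (v (s + 2))) + W (v s) (v (s + 2))"
proof
  \<comment> \<open>The new cycle starts just after the skipped vertex \<open>v (s + 1)\<close> and closes with the chord.\<close>
  let ?u = "\<lambda>j. v (s + 2 + j mod (k - 1))"
  obtain l where l: "k = Suc (Suc l)" "l \<noteq> 0"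
    using assms(1) by (cases k; cases "k - 1") auto
  have last: "v (s + 2 + l) = v s"
    using periodic_cycle_shift[of s] l by (simp add: add.commute)
  have "A (?u i) (?u (Suc i))" for i
  proof (cases "Suc (i mod (k - 1)) = k - 1")
    case True
    then have "i mod (k - 1) = l" using l by simp
    then show ?thesis using assms(2) last True l by (simp add: mod_Suc)
  next
    case False
    then show ?thesis
      using periodic_cycle_step[of "s + 2 + i mod (k - 1)"] by (simp add: mod_Suc)
  qed
  moreover have "?u i = ?u j \<longleftrightarrow> i mod (k - 1) = j mod (k - 1)" for i j
  proof (rule periodic_cycle_window_inj)
    show "i mod (k - 1) < k" "j mod (k - 1) < k"
      using l mod_less_divisor[of "k - 1" i] mod_less_divisor[of "k - 1" j] by linarith+
  qed
  ultimately show "periodic_cycle A (k - 1) ?u" by (simp add: periodic_cycle_def)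
  have "cycle_weight W (k - 1) ?u
      = (\<Sum>i<l. W (v (s + 2 + i)) (v (s + 2 + Suc i))) + W (v s) (v (s + 2))"
    using last l by (simp add: cycle_weight_def)
  moreover have "cycle_weight W k v = (\<Sum>i<Suc (Suc l). W (v (s + i)) (v (Suc (s + i))))"
    unfolding l(1)[symmetric] by (rule cycle_weight_window[symmetric])
  then have "cycle_weight W k v = W (v s) (v (Suc s)) + W (v (Suc s)) (v (s + 2))
      + (\<Sum>i<l. W (v (s + 2 + i)) (v (s + 2 + Suc i)))"
    unfolding sum.lessThan_Suc_shift by simp
  ultimately show "cycle_weight W (k - 1) ?u = cycle_weight W k v
      - (W (v s) (v (Suc s)) + W (v (Suc s)) (v (s + 2))) + W (v s) (v (s + 2))"
    by simp
qed

end

section \<open>Shortening ascending cycles\<close>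

text \<open>
  The properties of a valid weighted digraph on which the argument rests, for a simple digraph with
  adjacency \<open>A\<close> and arc weights \<open>W\<close>. Here \<open>M u v\<close> is the largest weight allowed on \<open>u \<rightarrow> v\<close>. No weight
  is below \<open>- M v u\<close>: if \<open>v \<rightarrow> u\<close> is present too, its weight is at most \<open>M v u - 1\<close>, so that
  \<open>u \<rightarrow> v\<close> has weight at least \<open>- M v u\<close>; otherwise the weight is \<open>M u v \<ge> 0\<close>.
\<close>

locale truncated_affine_weights =
  fixes a b :: int and V :: "'a::linorder set"
    and A :: "'a \<Rightarrow> 'a \<Rightarrow> bool" and W :: "'a \<Rightarrow> 'a \<Rightarrow> int"
    and M :: "'a \<Rightarrow> 'a \<Rightarrow> int"
  defines "M \<equiv> \<lambda>u v. if u < v then b - 1 else a - 1"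
  assumes ab: "1 \<le> a" "a \<le> b" "b \<le> a + 1"
    and A_in_V: "A u v \<Longrightarrow> u \<in> V \<and> v \<in> V \<and> u \<noteq> v"
    and weight_bounds: "A u v \<Longrightarrow> - M v u \<le> W u v \<and> W u v \<le> M u v"
    and opposite_arcs: "A u v \<Longrightarrow> A v u \<Longrightarrow> W u v + W v u = - 1"
    and single_arc: "u \<in> V \<Longrightarrow> v \<in> V \<Longrightarrow> u \<noteq> v \<Longrightarrow> \<not> A v u \<Longrightarrow> A u v \<and> W u v = M u v"
begin

lemma M_nonneg: "0 \<le> M u v"
  using ab by (simp add: M_def)

lemma M_le_Suc: "M u v \<le> M x y + 1"
  using ab by (simp add: M_def)

lemma M_less_imp: "M u v < M u w \<Longrightarrow> v \<le> u \<and> u < w"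
  using ab by (auto simp: M_def split: if_splits)

lemma large_pair_nonneg:
  assumes "A x y" "A y z" "W x y + W y z \<ge> M x z + 1"
  shows "0 \<le> W x y"
  using weight_bounds[OF assms(2)] M_le_Suc[of y z x z] assms(3) by linarith

text \<open>
  A large pair at \<open>y\<close> and \<open>W x y \<le> M x y\<close> force \<open>W y z \<ge> M x z + 1 - M x y \<ge> 0\<close>, while a small pair at \<open>z\<close> and
  \<open>W z t \<ge> - M t z\<close> would force \<open>W y z \<le> M t z - M t y - 1 \<le> 0\<close>. As \<open>M\<close> takes values in
  \<open>{a - 1, a}\<close>, equality must hold throughout: \<open>M x y = a\<close> and \<open>M x z = a - 1\<close> yield \<open>z \<le> x < y\<close>,
  whereas \<open>M t z = a\<close> and \<open>M t y = a - 1\<close> yield \<open>y \<le> t < z\<close>.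
\<close>

lemma pair_sign_propagates:
  assumes "A x y" "A z t" "W x y + W y z \<ge> M x z + 1"
  shows "\<not> W y z + W z t \<le> - M t y - 1"
proof
  assume "W y z + W z t \<le> - M t y - 1"
  then have "M x z + M t y + 2 \<le> M x y + M t z"
    using weight_bounds[OF assms(1)] weight_bounds[OF assms(2)] assms(3) by linarith
  then have "M x z < M x y" "M t y < M t z"
    using M_le_Suc[of x y x z] M_le_Suc[of t z t y] by linarith+
  then have "z \<le> x \<and> x < y" "y \<le> t \<and> t < z"
    using M_less_imp by blast+
  then show False by auto
qed

text \<open>
  In the large case the shortcut along the chord \<open>v i \<rightarrow> v (i + 2)\<close> is not ascending, in the small
  case the triangle closed by the chord \<open>v (i + 2) \<rightarrow> v i\<close> is not; the two arcs of the chord cannot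
  both be present, since their weights add up to only \<open>- 1\<close>.
\<close>

lemma pair_dichotomy:
  assumes cyc: "periodic_cycle A k v" and k: "k \<ge> 4" and asc: "0 \<le> cycle_weight W k v"
    and tri: "\<nexists>u. periodic_cycle A 3 u \<and> 0 \<le> cycle_weight W 3 u"
    and short: "\<nexists>u. periodic_cycle A (k - 1) u \<and> 0 \<le> cycle_weight W (k - 1) u"
  defines "e \<equiv> \<lambda>i. W (v i) (v (Suc i))"
  obtains
    (large) "e i + e (Suc i) \<ge> M (v i) (v (i + 2)) + 1"
      and "cycle_weight W k v - (e i + e (Suc i)) < 0"
  | (small) "e i + e (Suc i) \<le> - M (v (i + 2)) (v i) - 1"
proof -
  have "v (i + 0) \<noteq> v (i + 2)"
    by (subst periodic_cycle_window_inj[OF cyc]) (use k in auto)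
  then have ne: "v i \<noteq> v (i + 2)" by simp
  have inV: "v i \<in> V" "v (i + 2) \<in> V"
    using A_in_V periodic_cycle_step[OF cyc] by blast+
  have closing: "e i + e (Suc i) + W (v (i + 2)) (v i) < 0" if "A (v (i + 2)) (v i)"
  proof (rule triangle_of_back_chord[OF cyc _ that, where W = W])
    show "3 \<le> k" using k by simp
    fix u
    assume "periodic_cycle A 3 u"
      and u: "cycle_weight W 3 u =
        W (v i) (v (Suc i)) + W (v (Suc i)) (v (i + 2)) + W (v (i + 2)) (v i)"
    then have "cycle_weight W 3 u < 0" using tri by (auto simp: not_le)
    then show ?thesis unfolding u e_def by simp
  qed
  have shortcut: "cycle_weight W k v - (e i + e (Suc i)) + W (v i) (v (i + 2)) < 0"
    if "A (v i) (v (i + 2))"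
  proof (rule shortcut_of_forward_chord[OF cyc _ that, where W = W])
    show "3 \<le> k" using k by simp
    fix u
    assume "periodic_cycle A (k - 1) u"
      and u: "cycle_weight W (k - 1) u = cycle_weight W k v
        - (W (v i) (v (Suc i)) + W (v (Suc i)) (v (i + 2))) + W (v i) (v (i + 2))"
    then have "cycle_weight W (k - 1) u < 0" using short by (auto simp: not_le)
    then show ?thesis unfolding u e_def by simp
  qed
  show thesis
  proof (cases "A (v (i + 2)) (v i)")
    case True
    have "\<not> A (v i) (v (i + 2))"
    proof
      assume "A (v i) (v (i + 2))"
      then show False
        using closing[OF True] shortcut opposite_arcs[OF True] asc by linarith
    qed
    then have "W (v (i + 2)) (v i) = M (v (i + 2)) (v i)"
      using single_arc[OF inV(2,1)] ne by simp
    then show thesis using closing[OF True] small by simp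
  next
    case False
    then have "A (v i) (v (i + 2))" "W (v i) (v (i + 2)) = M (v i) (v (i + 2))"
      using single_arc[OF inV ne] by simp_all
    then have "cycle_weight W k v - (e i + e (Suc i)) + M (v i) (v (i + 2)) < 0"
      using shortcut by simp
    then show thesis using asc M_nonneg[of "v i" "v (i + 2)"] by (intro large) linarith+
  qed
qed

text \<open>
  By \<open>pair_sign_propagates\<close>, either all pairs of consecutive arcs are large or all are small; the
  first makes every arc nonnegative, the second makes the total weight negative.
\<close>

lemma ascending_cycle_reduces:
  assumes cyc: "periodic_cycle A k v" and k: "k \<ge> 4" and asc: "0 \<le> cycle_weight W k v"
  shows "(\<exists>u. periodic_cycle A 3 u \<and> 0 \<le> cycle_weight W 3 u) \<or>
    (\<exists>u. periodic_cycle A (k - 1) u \<and> 0 \<le> cycle_weight W (k - 1) u)"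
proof (rule ccontr)
  assume no: "\<not> ?thesis"
  define e where "e i = W (v i) (v (Suc i))" for i
  let ?large = "\<lambda>i. e i + e (Suc i) \<ge> M (v i) (v (i + 2)) + 1"
  let ?small = "\<lambda>i. e i + e (Suc i) \<le> - M (v (i + 2)) (v i) - 1"
  have dich: "?large i \<and> cycle_weight W k v - (e i + e (Suc i)) < 0 \<or> ?small i" for i
    using pair_dichotomy[OF cyc k asc, of i] no unfolding e_def by blast
  note step = periodic_cycle_step[OF cyc]
  have window: "(\<Sum>i<k. e (s + i)) = cycle_weight W k v" for s
    using cycle_weight_window[OF cyc, where W = W] by (simp add: e_def)
  show False
  proof (cases "\<exists>i. ?large i")
    case True
    then obtain i where "?large i" by blast
    have all_large: "?large (i + j)" for j
    proof (induction j)
      case 0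
      show ?case using \<open>?large i\<close> by simp
    next
      case (Suc j)
      have "\<not> ?small (Suc (i + j))"
        using pair_sign_propagates[OF step[of "i + j"] step] Suc
        by (simp add: e_def)
      then show ?case using dich[of "Suc (i + j)"] by simp
    qed
    have nonneg: "0 \<le> e (i + j)" for j
      using large_pair_nonneg[OF step[of "i + j"] step] all_large[of j]
      by (simp add: e_def)
    obtain l where l: "k = Suc (Suc l)"
      using k by (cases k; cases "k - 1") auto
    \<comment> \<open>What remains after removing the large pair \<open>i\<close> would be negative, although no arc is.\<close>
    have "cycle_weight W k v = (\<Sum>j<Suc (Suc l). e (i + j))"
      unfolding l[symmetric] by (rule window[symmetric])
    then have "cycle_weight W k v - (e i + e (Suc i)) = (\<Sum>j<l. e (i + Suc (Suc j)))"
      unfolding sum.lessThan_Suc_shift by simp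
    also have "\<dots> \<ge> 0" by (intro sum_nonneg nonneg)
    finally have "\<not> cycle_weight W k v - (e i + e (Suc i)) < 0" by simp
    moreover have "\<not> ?small i"
      using \<open>?large i\<close> M_nonneg[of "v i" "v (i + 2)"] M_nonneg[of "v (i + 2)" "v i"] by linarith
    ultimately show False using dich[of i] by blast
  next
    case False
    have "e i + e (Suc i) < 0" for i
      using dich[of i] False M_nonneg[of "v (i + 2)" "v i"] by fastforce
    then have "(\<Sum>i<k. e i + e (Suc i)) < (\<Sum>i<k. 0)"
      using k by (intro sum_strict_mono) (auto simp: lessThan_empty_iff)
    moreover have "(\<Sum>i<k. e i + e (Suc i)) = 2 * cycle_weight W k v"
      using window[of 0] window[of 1] by (simp add: sum.distrib)
    ultimately show False using asc by simp
  qed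
qed

lemma ascending_cycle_length:
  assumes cyc: "periodic_cycle A k v" and "0 < k" and asc: "0 \<le> cycle_weight W k v"
  shows "3 \<le> k"
proof (rule ccontr)
  assume "\<not> 3 \<le> k"
  then consider "k = 1" | "k = 2" using \<open>0 < k\<close> by linarith
  then show False
  proof cases
    case 1
    then show False
      using periodic_cycle_step[OF cyc, of 0] periodic_cycle_shift[OF cyc, of 0] A_in_V by fastforce
  next
    case 2
    then have v2: "v (Suc (Suc 0)) = v 0"
      using periodic_cycle_shift[OF cyc, of 0] by simp
    have "A (v 0) (v (Suc 0))" "A (v (Suc 0)) (v 0)"
      using periodic_cycle_step[OF cyc, of 0] periodic_cycle_step[OF cyc, of "Suc 0"] v2 by simp_all
    then show False
      using opposite_arcs[of "v 0" "v (Suc 0)"] asc 2 v2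
      by (simp add: cycle_weight_def numeral_2_eq_2)
  qed
qed

lemma ascending_triangle_of_ascending_cycle:
  assumes "periodic_cycle A k v" "3 \<le> k" "0 \<le> cycle_weight W k v"
  shows "\<exists>u. periodic_cycle A 3 u \<and> 0 \<le> cycle_weight W 3 u"
  using assms(2,1,3)
proof (induction k arbitrary: v rule: dec_induct)
  case (step k)
  show ?case using ascending_cycle_reduces[OF step.prems(1) _ step.prems(2)] step by auto
qed blast

end

section \<open>Valid weighted digraphs\<close>

definition adjacent :: "('a, 'e) pre_digraph \<Rightarrow> 'a \<Rightarrow> 'a \<Rightarrow> bool" where
  "adjacent G u v \<longleftrightarrow> arcs_between G u v \<noteq> {}"

definition arc_weight :: "('a, 'e) pre_digraph \<Rightarrow> ('e \<Rightarrow> int) \<Rightarrow> 'a \<Rightarrow> 'a \<Rightarrow> int" where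
  "arc_weight G c u v = c (the_elem (arcs_between G u v))"

lemma unique_arc_adjacent:
  "unique_arc_of_weight G c u v w \<Longrightarrow> adjacent G u v \<and> arc_weight G c u v = w"
  by (auto simp: unique_arc_of_weight_def adjacent_def arc_weight_def)

text \<open>
  Without parallel arcs, cycles of arcs correspond to periodic vertex sequences. The converse is
  spelled out for triangles only, as these are the cycles to be produced in the end.
\<close>

lemma (in nomulti_digraph) cycle_vertex_sequence:
  assumes "cycle p"
  obtains v where "periodic_cycle (adjacent G) (length p) v"
    and "cycle_weight (arc_weight G c) (length p) v = (\<Sum>e\<leftarrow>p. c e)"
proof
  let ?k = "length p"
  let ?v = "\<lambda>i. tail G (p ! (i mod ?k))"
  obtain u where u: "awalk u p u" "distinct (tl (awalk_verts u p))" "p \<noteq> []"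
    using assms(1) by (auto simp: cycle_def)
  then have verts: "map (tail G) p @ [u] = u # map (head G) p"
    using awalk_verts_conv[of u p] awalk_verts_conv'[of u p u]
    by (metis awalkE awlast_of_awalk last_snoc awalk_verts_conv' hd_append2 list.sel(1)
        awhd_of_awalk map_is_Nil_conv)
  have k: "0 < ?k" using u by simp
  \<comment> \<open>The definition of a cycle asks for distinct heads; the tails are the same vertices, rotated.\<close>
  have dist: "distinct (map (tail G) p)"
  proof -
    have "tl (awalk_verts u p) = map (head G) p"
      using u awalk_verts_conv'[of u p u] by (auto simp: awalk_def)
    then have "distinct (map (head G) p)" using u by simp
    moreover have "mset (map (tail G) p) = mset (map (head G) p)"
      using arg_cong[OF verts, of mset] by simp
    ultimately show ?thesis using mset_eq_imp_distinct_iff by blast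
  qed
  have head_v: "head G (p ! (i mod ?k)) = ?v (Suc i)" for i
  proof -
    have lt: "i mod ?k < ?k" using k by simp
    have "head G (p ! (i mod ?k)) = (map (tail G) p @ [u]) ! Suc (i mod ?k)"
      unfolding verts using lt by simp
    moreover have "u = tail G (p ! 0)"
      using arg_cong[OF verts, of hd] u(3) by (cases p) auto
    ultimately show ?thesis using lt by (auto simp: mod_Suc nth_append)
  qed
  have arc: "arcs_between G (?v i) (?v (Suc i)) = {p ! (i mod ?k)}" for i
  proof -
    have "p ! (i mod ?k) \<in> arcs G" using u k by (auto simp: awalk_def)
    then show ?thesis using head_v[of i] no_multi_arcs by (auto simp: arcs_between_def arc_to_ends_def)
  qed
  show "periodic_cycle (adjacent G) ?k ?v"
    unfolding periodic_cycle_def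
  proof (intro conjI allI)
    show "adjacent G (?v i) (?v (Suc i))" for i
      using arc by (simp add: adjacent_def)
    show "?v i = ?v j \<longleftrightarrow> i mod ?k = j mod ?k" for i j
      using nth_eq_iff_index_eq[OF dist, of "i mod ?k" "j mod ?k"] k by simp
  qed
  show "cycle_weight (arc_weight G c) ?k ?v = (\<Sum>e\<leftarrow>p. c e)"
    unfolding cycle_weight_def arc_weight_def arc
    by (simp add: sum_list_sum_nth atLeast0LessThan)
qed

lemma (in nomulti_digraph) triangle_of_vertex_sequence:
  assumes cyc: "periodic_cycle (adjacent G) 3 v"
  obtains p where "cycle p" "length p = 3"
    and "(\<Sum>e\<leftarrow>p. c e) = cycle_weight (arc_weight G c) 3 v"
proof
  define e where "e i = the_elem (arcs_between G (v i) (v (Suc i)))" for i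
  have e: "e i \<in> arcs G \<and> tail G (e i) = v i \<and> head G (e i) = v (Suc i)" for i
  proof -
    obtain f where f: "f \<in> arcs_between G (v i) (v (Suc i))"
      using periodic_cycle_step[OF cyc, of i] by (auto simp: adjacent_def)
    then have "arcs_between G (v i) (v (Suc i)) = {f}"
      using no_multi_arcs by (auto simp: arcs_between_def arc_to_ends_def)
    then have "e i = f" by (simp add: e_def)
    then show ?thesis using f by (simp add: arcs_between_def)
  qed
  let ?p = "[e 0, e 1, e 2]"
  have v3: "v 3 = v 0" using periodic_cycle_shift[OF cyc, of 0] by simp
  have ne: "v 1 \<noteq> v 2" "v 1 \<noteq> v 0" "v 2 \<noteq> v 0"
    using cyc unfolding periodic_cycle_def by simp_all
  have hd: "head G (e 0) = v 1" "head G (e 1) = v 2" "head G (e 2) = v 0"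
    using e[of 0] e[of 1] e[of 2] v3 by (simp_all add: numeral_2_eq_2 numeral_3_eq_3)
  have "v 0 \<in> verts G" using e[of 0] tail_in_verts by metis
  then have "awalk (v 0) ?p (v 0)" using e hd by (simp add: awalk_def)
  moreover have "distinct (tl (awalk_verts (v 0) ?p))" using e hd ne by simp
  ultimately show "cycle ?p" unfolding cycle_def by blast
  show "length ?p = 3" by simp
  show "(\<Sum>e\<leftarrow>?p. c e) = cycle_weight (arc_weight G c) 3 v"
    unfolding cycle_weight_3 by (simp add: arc_weight_def e_def numeral_2_eq_2 numeral_3_eq_3)
qed

lemma valid_pair_cases:
  assumes "valid_weighted_digraph a b n G c" "i \<in> {1..n}" "j \<in> {1..n}" "i < j"
  obtains
    (backward) "\<not> adjacent G i j" and "unique_arc_of_weight G c j i (a - 1)"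
  | (both) w where "1 - a \<le> w" and "w \<le> b - 2"
      and "unique_arc_of_weight G c i j w" and "unique_arc_of_weight G c j i (- w - 1)"
  | (forward) "unique_arc_of_weight G c i j (b - 1)" and "\<not> adjacent G j i"
proof -
  have "only_backward_arc a G c i j \<or> arcs_both_ways a b G c i j \<or> only_forward_arc b G c i j"
    using assms unfolding valid_weighted_digraph_def by blast
  then show thesis
    using backward both forward
    unfolding only_backward_arc_def arcs_both_ways_def only_forward_arc_def adjacent_def by blast
qed

lemma valid_weighted_digraph_nomulti:
  assumes valid: "valid_weighted_digraph a b n G c"
  shows "nomulti_digraph G"
proof -
  interpret loopfree_digraph G
    using valid by (simp add: valid_weighted_digraph_def)
  show ?thesis
  proof
    fix e f assume e: "e \<in> arcs G" and f: "f \<in> arcs G" and "arc_to_ends G e = arc_to_ends G f"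
    then have tl: "tail G e = tail G f" and hd: "head G e = head G f"
      by (simp_all add: arc_to_ends_def)
    let ?u = "tail G e" and ?v = "head G e"
    have V: "?u \<in> {1..n}" "?v \<in> {1..n}" "?u \<noteq> ?v"
      using e valid tail_in_verts head_in_verts no_loops unfolding valid_weighted_digraph_def by blast+
    have ef: "e \<in> arcs_between G ?u ?v" "f \<in> arcs_between G ?u ?v"
      using e f tl hd by (auto simp: arcs_between_def)
    have "\<exists>w. unique_arc_of_weight G c ?u ?v w"
    proof (cases "?u < ?v")
      case True
      show ?thesis
        by (rule valid_pair_cases[OF valid V(1,2) True]) (use ef in \<open>auto simp: adjacent_def\<close>)
    next
      case False
      then have less: "?v < ?u" using V by simp
      show ?thesis
        by (rule valid_pair_cases[OF valid V(2,1) less]) (use ef in \<open>auto simp: adjacent_def\<close>)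
    qed
    then show "e = f" using ef by (auto simp: unique_arc_of_weight_def)
  qed
qed

lemma truncated_affine_weights_of_valid:
  assumes ab: "1 \<le> a" "a \<le> b" "b \<le> a + 1"
    and valid: "valid_weighted_digraph a b n G c"
  shows "truncated_affine_weights a b {1..n} (adjacent G) (arc_weight G c)"
proof -
  interpret loopfree_digraph G
    using valid by (simp add: valid_weighted_digraph_def)
  let ?A = "adjacent G" and ?W = "arc_weight G c"
  let ?M = "\<lambda>u v. if u < v then b - 1 else a - 1"
  have inV: "u \<in> {1..n} \<and> v \<in> {1..n} \<and> u \<noteq> v" if uv: "?A u v" for u v
  proof -
    obtain e where e: "e \<in> arcs G" "tail G e = u" "head G e = v"
      using uv by (auto simp: adjacent_def arcs_between_def)
    have "verts G = {1..n}" using valid by (simp add: valid_weighted_digraph_def)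
    then show ?thesis
      using e(2,3) tail_in_verts[OF e(1)] head_in_verts[OF e(1)] no_loops[OF e(1)] by simp
  qed
  have pair: "(?A u v \<longrightarrow> - ?M v u \<le> ?W u v \<and> ?W u v \<le> ?M u v) \<and>
      (?A v u \<longrightarrow> - ?M u v \<le> ?W v u \<and> ?W v u \<le> ?M v u) \<and>
      (?A u v \<and> ?A v u \<longrightarrow> ?W u v + ?W v u = - 1) \<and>
      (\<not> ?A v u \<longrightarrow> ?A u v \<and> ?W u v = ?M u v) \<and>
      (\<not> ?A u v \<longrightarrow> ?A v u \<and> ?W v u = ?M v u)"
    if V: "u \<in> {1..n}" "v \<in> {1..n}" and less: "u < v" for u v
    using valid V less
  proof (cases rule: valid_pair_cases)
    case backward
    then show ?thesis using unique_arc_adjacent[OF backward(2)] less ab by auto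
  next
    case (both w)
    then show ?thesis
      using unique_arc_adjacent[OF both(3)] unique_arc_adjacent[OF both(4)] less ab by auto
  next
    case forward
    then show ?thesis using unique_arc_adjacent[OF forward(1)] less ab by auto
  qed
  show ?thesis
  proof
    show "1 \<le> a" "a \<le> b" "b \<le> a + 1" by (fact ab)+
    show "?A u v \<Longrightarrow> u \<in> {1..n} \<and> v \<in> {1..n} \<and> u \<noteq> v" for u v by (fact inV)
    show "?A u v \<Longrightarrow> - ?M v u \<le> ?W u v \<and> ?W u v \<le> ?M u v" for u v
      using inV[of u v] pair[of u v] pair[of v u] by (meson linorder_less_linear)
    show "?A u v \<Longrightarrow> ?A v u \<Longrightarrow> ?W u v + ?W v u = - 1" for u v
      using inV[of u v] pair[of u v] pair[of v u] by (metis add.commute linorder_less_linear)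
    show "u \<in> {1..n} \<Longrightarrow> v \<in> {1..n} \<Longrightarrow> u \<noteq> v \<Longrightarrow> \<not> ?A v u \<Longrightarrow> ?A u v \<and> ?W u v = ?M u v" for u v
      using pair[of u v] pair[of v u] by (meson linorder_less_linear)
  qed
qed

theorem theorem5p13:
  fixes a b :: int and n :: nat
    and G :: "(nat, 'e) pre_digraph" and c :: "'e \<Rightarrow> int"
  assumes "1 \<le> a" and "a \<le> b" and "b \<le> a + 1"
    and "valid_weighted_digraph a b n G c"
  shows "m_acyclic G c \<longleftrightarrow> \<not> (\<exists>p. m_ascending_cycle G c p \<and> length p = 3)"
proof -
  interpret nomulti_digraph G
    by (rule valid_weighted_digraph_nomulti[OF assms(4)])
  interpret truncated_affine_weights a b "{1..n}" "adjacent G" "arc_weight G c"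
    "\<lambda>u v. if u < v then b - 1 else a - 1"
    by (rule truncated_affine_weights_of_valid[OF assms]) simp
  have "\<exists>q. m_ascending_cycle G c q \<and> length q = 3" if asc: "m_ascending_cycle G c p" for p
  proof -
    have "cycle p" "0 \<le> (\<Sum>e\<leftarrow>p. c e)"
      using asc by (auto simp: m_ascending_cycle_def)
    then obtain v where v: "periodic_cycle (adjacent G) (length p) v"
      "0 \<le> cycle_weight (arc_weight G c) (length p) v"
      using cycle_vertex_sequence[OF \<open>cycle p\<close>] by metis
    have "0 < length p" using \<open>cycle p\<close> by (auto simp: cycle_def)
    then obtain u where u: "periodic_cycle (adjacent G) 3 u" "0 \<le> cycle_weight (arc_weight G c) 3 u"
      using ascending_triangle_of_ascending_cycle[OF v(1) _ v(2)] ascending_cycle_length v by blast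
    obtain q where "cycle q" "length q = 3"
      "(\<Sum>e\<leftarrow>q. c e) = cycle_weight (arc_weight G c) 3 u"
      by (rule triangle_of_vertex_sequence[OF u(1)])
    then show ?thesis using u(2) by (auto simp: m_ascending_cycle_def)
  qed
  then show ?thesis unfolding m_acyclic_def by blast
qed

end
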